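(* Let $\mathbf{k}$ be a commutative ring with unit. There exists a unique isomorphism of unitary associative algebras $$\Theta:(\mathbf{k}\mathcal{F},\cdot,\mathbf{1})\longrightarrow(H_{\rm LR}^{\epsilon},\backslash,|)$$ such that $$\Theta(B^+(F))=B^{r}(\Theta(F))=\Theta(F)\vee|,\quad\forall\,F\in\mathcal{F}.$$
   Context: All modules, algebras, tensor products and linear maps are over $\mathbf{k}$. Planar binary trees: a planar binary tree is a finite rooted planar tree in which every internal vertex has exactly two ordered incoming branches (left and right). The trivial tree, with no internal vertices, is denoted $|$. Let $\mathcal{Y}$ be the set of planar binary trees and $H_{\rm LR}^{\epsilon}:=\mathbf{k}\mathcal{Y}$ the free $\mathbf{k}$-module on it. Grafting: for $T_l,T_r\in\mathcal{Y}$, $T_l\vee T_r$ is the tree obtained by creating a new root with left branch $T_l$ and right branch $T_r$; $\vee$ is extended bilinearly. Every $T\in\mathcal{Y}$ with $T\neq |$ is uniquely of the form $T=T_l\vee T_r$. The operator $B^{r}:H_{\rm LR}^{\epsilon}\to H_{\rm LR}^{\epsilon}$ is the linear map with $B^{r}(T)=T\vee|$ for $T\in\mathcal{Y}$. Under product: the bilinear map $\backslash$ on $H_{\rm LR}^{\epsilon}$ where, for trees $S,T$, $S\backslash T$ is obtained by adjoining the root of $T$ to the rightmost branch of $S$; recursively, $|\backslash T=T$ and $(S_l\vee S_r)\backslash T=S_l\vee(S_r\backslash T)$. It is associative with unit $|$. Planar rooted forests: $\mathcal{F}$ is the set of planar rooted forests, i.e. finite (possibly empty) ordered sequences $t_1\cdots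 t_m$ of planar rooted trees (with arbitrary numbers of children, ordered); $\mathbf{1}$ is the empty forest and $\cdot$ is concatenation, extended bilinearly to the free $\mathbf{k}$-module $\mathbf{k}\mathcal{F}$. The operator $B^+$ sends a forest to the planar rooted tree obtained by grafting its roots, in order, to a new common root. Every planar rooted tree is uniquely $B^+(F)$ with $F\in\mathcal{F}$. *)

theory Defs
  imports "HOL-Library.Poly_Mapping"
begin

text \<open>
  The ground ring is a type of sort \<open>{comm_ring, comm_monoid_mult}\<close>, i.e. a commutative ring with
  unit in which, unlike in \<open>comm_ring_1\<close>, the case \<open>0 = 1\<close> is not excluded. The module laws below
  are those of the locale \<open>module\<close> of the library, which is restricted to \<open>comm_ring_1\<close>.
\<close>

locale unital_assoc_algebra =
  fixes scale :: "'k::{comm_ring, comm_monoid_mult} \<Rightarrow> 'a::ab_group_add \<Rightarrow> 'a"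
    and mult :: "'a \<Rightarrow> 'a \<Rightarrow> 'a"
    and unit :: 'a
  assumes scale_right_distrib: "scale c (x + y) = scale c x + scale c y"
    and scale_left_distrib: "scale (c + d) x = scale c x + scale d x"
    and scale_scale: "scale c (scale d x) = scale (c * d) x"
    and scale_one: "scale 1 x = x"
    and mult_add_left: "mult (x + y) z = mult x z + mult y z"
    and mult_add_right: "mult x (y + z) = mult x y + mult x z"
    and mult_scale_left: "mult (scale c x) y = scale c (mult x y)"
    and mult_scale_right: "mult x (scale c y) = scale c (mult x y)"
    and mult_assoc: "mult (mult x y) z = mult x (mult y z)"
    and mult_unit_left: "mult unit x = x"
    and mult_unit_right: "mult x unit = x"

locale unital_algebra_iso =
  A: unital_assoc_algebra scaleA multA unitA +
  B: unital_assoc_algebra scaleB multB unitB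
  for scaleA :: "'k::{comm_ring, comm_monoid_mult} \<Rightarrow> 'a::ab_group_add \<Rightarrow> 'a"
    and multA unitA
    and scaleB :: "'k \<Rightarrow> 'b::ab_group_add \<Rightarrow> 'b"
    and multB unitB +
  fixes f :: "'a \<Rightarrow> 'b"
  assumes add: "f (x + y) = f x + f y"
    and scale: "f (scaleA c x) = scaleB c (f x)"
    and mult: "f (multA x y) = multB (f x) (f y)"
    and unit: "f unitA = unitB"
    and bij: "bij f"

text \<open>
  The free module on a type \<open>'a\<close> is \<open>'a \<Rightarrow>\<^sub>0 'k\<close>, the finitely supported functions.
\<close>

definition free_scale :: "'k::{comm_ring, comm_monoid_mult} \<Rightarrow> ('a \<Rightarrow>\<^sub>0 'k) \<Rightarrow> ('a \<Rightarrow>\<^sub>0 'k)" where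
  "free_scale c x = Poly_Mapping.map (\<lambda>d. c * d) x"

definition free_basis :: "'a \<Rightarrow> ('a \<Rightarrow>\<^sub>0 'k::{comm_ring, comm_monoid_mult})" where
  "free_basis a = Poly_Mapping.single a 1"

definition linear_extension ::
  "('a \<Rightarrow> 'b) \<Rightarrow> ('a \<Rightarrow>\<^sub>0 'k::{comm_ring, comm_monoid_mult}) \<Rightarrow> ('b \<Rightarrow>\<^sub>0 'k)" where
  "linear_extension g x =
     (\<Sum>a\<in>Poly_Mapping.keys x. free_scale (Poly_Mapping.lookup x a) (free_basis (g a)))"

definition bilinear_extension ::
  "('a \<Rightarrow> 'b \<Rightarrow> 'c) \<Rightarrow> ('a \<Rightarrow>\<^sub>0 'k::{comm_ring, comm_monoid_mult}) \<Rightarrow> ('b \<Rightarrow>\<^sub>0 'k) \<Rightarrow> ('c \<Rightarrow>\<^sub>0 'k)" where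
  "bilinear_extension g x y =
     (\<Sum>a\<in>Poly_Mapping.keys x. \<Sum>b\<in>Poly_Mapping.keys y.
        free_scale (Poly_Mapping.lookup x a * Poly_Mapping.lookup y b) (free_basis (g a b)))"

datatype binary_tree = Trivial | Graft binary_tree binary_tree

fun under_tree :: "binary_tree \<Rightarrow> binary_tree \<Rightarrow> binary_tree" where
  "under_tree Trivial T = T"
| "under_tree (Graft S\<^sub>l S\<^sub>r) T = Graft S\<^sub>l (under_tree S\<^sub>r T)"

definition under_product ::
  "(binary_tree \<Rightarrow>\<^sub>0 'k::{comm_ring, comm_monoid_mult}) \<Rightarrow> (binary_tree \<Rightarrow>\<^sub>0 'k) \<Rightarrow> (binary_tree \<Rightarrow>\<^sub>0 'k)" where
  "under_product = bilinear_extension under_tree"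

definition graft ::
  "(binary_tree \<Rightarrow>\<^sub>0 'k::{comm_ring, comm_monoid_mult}) \<Rightarrow> (binary_tree \<Rightarrow>\<^sub>0 'k) \<Rightarrow> (binary_tree \<Rightarrow>\<^sub>0 'k)" where
  "graft = bilinear_extension Graft"

definition B_right ::
  "(binary_tree \<Rightarrow>\<^sub>0 'k::{comm_ring, comm_monoid_mult}) \<Rightarrow> (binary_tree \<Rightarrow>\<^sub>0 'k)" where
  "B_right = linear_extension (\<lambda>T. Graft T Trivial)"

text \<open>
  The constructor \<open>B_plus\<close> is the operator $B^+$: a planar rooted tree is its root together with
  the planar forest of its branches, and a planar forest is a list of planar rooted trees. A tree
  \<open>t\<close> regarded as a forest is \<open>[t]\<close>.
\<close>

datatype planar_tree = B_plus "planar_tree list"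

type_synonym planar_forest = "planar_tree list"

definition concat_product ::
  "(planar_forest \<Rightarrow>\<^sub>0 'k::{comm_ring, comm_monoid_mult}) \<Rightarrow> (planar_forest \<Rightarrow>\<^sub>0 'k) \<Rightarrow> (planar_forest \<Rightarrow>\<^sub>0 'k)" where
  "concat_product = bilinear_extension (@)"

end

theory Submission
  imports Defs
begin

text \<open>
  The statement is the linearisation of a fact about monoids. In \<open>(binary_tree, \<backslash>, |)\<close> one has
  $(T \vee |) \backslash S = T \vee S$. A multiplicative map that sends $B^+(F)$ to
  $\Theta(F) \vee |$ must therefore send a nonempty forest $B^+(F)\,G$, with first tree $B^+(F)$, to
  $\Theta(F) \vee \Theta(G)$. Together with $\mathbf{1} \mapsto |$ this is a recursion over forests
  that has exactly one solution \<open>forest_to_tree\<close>; it is the classical correspondence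
  between planar forests and planar binary trees in which the branches of the first tree of a forest
  go to the left and its later siblings to the right. Since a binary tree is either $|$ or uniquely
  $T_l \vee T_r$, and a forest is either empty or uniquely $B^+(F)\,G$, it is a bijection.

  Both algebras are monoid algebras (\<open>unital_assoc_algebra_bilinear_extension\<close>), and the linear
  extension of a monoid isomorphism is an isomorphism of monoid algebras
  (\<open>unital_algebra_iso_linear_extension\<close>), which gives existence. For uniqueness, the recursion
  determines \<open>\<Theta>\<close> on the basis of forests (\<open>eq_forest_to_tree_on_basis\<close>), hence
  everywhere by linearity.
\<close>

lemma lookup_free_scale [simp]:
  "Poly_Mapping.lookup (free_scale c x) a = c * Poly_Mapping.lookup x a"
  by (simp add: free_scale_def map.rep_eq when_def)

lemma free_scale_add_right: "free_scale c (x + y) = free_scale c x + free_scale c y"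
  by (rule poly_mapping_eqI) (simp add: lookup_add distrib_left)

lemma free_scale_add_left: "free_scale (c + d) x = free_scale c x + free_scale d x"
  by (rule poly_mapping_eqI) (simp add: lookup_add distrib_right)

lemma free_scale_free_scale: "free_scale c (free_scale d x) = free_scale (c * d) x"
  by (rule poly_mapping_eqI) (simp add: mult.assoc)

lemma free_scale_one [simp]: "free_scale 1 x = x"
  by (rule poly_mapping_eqI) simp

lemma free_scale_zero_left [simp]: "free_scale 0 x = 0"
  by (rule poly_mapping_eqI) simp

lemma free_scale_zero_right [simp]: "free_scale c 0 = 0"
  by (rule poly_mapping_eqI) simp

lemma free_scale_sum: "free_scale c (sum h A) = (\<Sum>a\<in>A. free_scale c (h a))"
  by (induction A rule: infinite_finite_induct) (simp_all add: free_scale_add_right)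

lemma free_module_induct [case_names basis add scale]:
  assumes "\<And>a. P (free_basis a)"
    and "\<And>x y. P x \<Longrightarrow> P y \<Longrightarrow> P (x + y)"
    and "\<And>c x. P x \<Longrightarrow> P (free_scale c x)"
  shows "P x"
proof (induction x rule: update_induct)
  case const
  \<comment> \<open>the zero vector is the multiple by \<open>0\<close> of any basis element\<close>
  show ?case
    using assms(3)[OF assms(1), of 0 undefined] by simp
next
  case (update x a c)
  have "Poly_Mapping.update a c x = x + free_scale c (free_basis a)"
  proof (rule poly_mapping_eqI)
    fix b
    show "Poly_Mapping.lookup (Poly_Mapping.update a c x) b =
        Poly_Mapping.lookup (x + free_scale c (free_basis a)) b"
      using \<open>a \<notin> Poly_Mapping.keys x\<close>
      by (auto simp: lookup_update lookup_add lookup_single free_basis_def in_keys_iff when_def)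
  qed
  then show ?case
    using assms update.IH by simp
qed

text \<open>
  The universal property of the free module. Allowing arbitrary vectors \<open>h a\<close> as values
  makes both \<open>linear_extension\<close> and, by iteration, \<open>bilinear_extension\<close> instances of it.
\<close>

definition free_lift ::
  "('a \<Rightarrow> ('b \<Rightarrow>\<^sub>0 'k)) \<Rightarrow> ('a \<Rightarrow>\<^sub>0 'k::{comm_ring, comm_monoid_mult}) \<Rightarrow> ('b \<Rightarrow>\<^sub>0 'k)" where
  "free_lift h x = (\<Sum>a\<in>Poly_Mapping.keys x. free_scale (Poly_Mapping.lookup x a) (h a))"

text \<open>
  The support of \<open>x + y\<close> or of a scalar multiple can be smaller than those of its constituents,
  because of cancellation and zero divisors; and \<open>free_basis a\<close> has empty support over the zero
  ring. Summing over any finite set that contains the support removes these case distinctions.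
\<close>

lemma free_lift_superset:
  assumes "finite A" "Poly_Mapping.keys x \<subseteq> A"
  shows "free_lift h x = (\<Sum>a\<in>A. free_scale (Poly_Mapping.lookup x a) (h a))"
  unfolding free_lift_def
  using assms by (intro sum.mono_neutral_left) (auto simp: in_keys_iff)

lemma free_lift_add: "free_lift h (x + y) = free_lift h x + free_lift h y"
proof -
  let ?A = "Poly_Mapping.keys x \<union> Poly_Mapping.keys y"
  have "Poly_Mapping.keys (x + y) \<subseteq> ?A"
    by (rule keys_add)
  then show ?thesis
    by (simp add: free_lift_superset[of ?A] lookup_add free_scale_add_left sum.distrib)
qed

lemma free_lift_scale: "free_lift h (free_scale c x) = free_scale c (free_lift h x)"
proof -
  have "Poly_Mapping.keys (free_scale c x) \<subseteq> Poly_Mapping.keys x"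
    by (auto simp: in_keys_iff)
  then show ?thesis
    by (simp add: free_lift_superset[of "Poly_Mapping.keys x"] free_scale_sum free_scale_free_scale)
qed

lemma free_lift_basis: "free_lift h (free_basis a) = h a"
proof -
  have "Poly_Mapping.keys (free_basis a) \<subseteq> {a}"
    by (auto simp: free_basis_def)
  then have "free_lift h (free_basis a) =
      (\<Sum>b\<in>{a}. free_scale (Poly_Mapping.lookup (free_basis a) b) (h b))"
    by (intro free_lift_superset) simp_all
  then show ?thesis
    by (simp add: free_basis_def)
qed

lemma free_lift_add_fun: "free_lift (\<lambda>a. h a + h' a) x = free_lift h x + free_lift h' x"
  by (simp add: free_lift_def free_scale_add_right sum.distrib)

lemma free_lift_scale_fun: "free_lift (\<lambda>a. free_scale c (h a)) x = free_scale c (free_lift h x)"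
  by (simp add: free_lift_def free_scale_sum free_scale_free_scale mult.commute)

lemma linear_extension_eq_free_lift: "linear_extension g = free_lift (\<lambda>a. free_basis (g a))"
  by (rule ext) (simp add: linear_extension_def free_lift_def)

lemma bilinear_extension_eq_free_lift:
  "bilinear_extension g x y = free_lift (\<lambda>a. free_lift (\<lambda>b. free_basis (g a b)) y) x"
  by (simp add: bilinear_extension_def free_lift_def free_scale_sum free_scale_free_scale)

lemmas linear_extension_simps =
  free_lift_add[of "\<lambda>a. free_basis (g a)" for g, folded linear_extension_eq_free_lift]
  free_lift_scale[of "\<lambda>a. free_basis (g a)" for g, folded linear_extension_eq_free_lift]
  free_lift_basis[of "\<lambda>a. free_basis (g a)" for g, folded linear_extension_eq_free_lift]

lemma bilinear_extension_simps:
  "bilinear_extension g (x + x') y = bilinear_extension g x y + bilinear_extension g x' y"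
  "bilinear_extension g x (y + y') = bilinear_extension g x y + bilinear_extension g x y'"
  "bilinear_extension g (free_scale c x) y = free_scale c (bilinear_extension g x y)"
  "bilinear_extension g x (free_scale c y) = free_scale c (bilinear_extension g x y)"
  "bilinear_extension g (free_basis a) (free_basis b) = free_basis (g a b)"
  by (simp_all add: bilinear_extension_eq_free_lift free_lift_add free_lift_scale free_lift_basis
      free_lift_add_fun free_lift_scale_fun)

text \<open>
  The monoid algebra of a monoid. Each law is linear in every variable, so that it suffices to
  check it on basis elements, where it is the corresponding law of the monoid.
\<close>

lemma unital_assoc_algebra_bilinear_extension:
  fixes g :: "'a \<Rightarrow> 'a \<Rightarrow> 'a"
  assumes assoc: "\<And>a b c. g (g a b) c = g a (g b c)"
    and unit_left: "\<And>a. g e a = a"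
    and unit_right: "\<And>a. g a e = a"
  shows "unital_assoc_algebra
    (free_scale :: 'k::{comm_ring, comm_monoid_mult} \<Rightarrow> ('a \<Rightarrow>\<^sub>0 'k) \<Rightarrow> ('a \<Rightarrow>\<^sub>0 'k))
    (bilinear_extension g) (free_basis e)"
proof
  fix x y z :: "'a \<Rightarrow>\<^sub>0 'k"
  have basis: "bilinear_extension g (bilinear_extension g (free_basis a) (free_basis b)) z =
      bilinear_extension g (free_basis a) (bilinear_extension g (free_basis b) z)" for a b
    by (induction z rule: free_module_induct) (simp_all add: bilinear_extension_simps assoc)
  have "bilinear_extension g (bilinear_extension g (free_basis a) y) z =
      bilinear_extension g (free_basis a) (bilinear_extension g y z)" for a
    by (induction y rule: free_module_induct) (simp_all add: bilinear_extension_simps(1-4) basis)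
  then show "bilinear_extension g (bilinear_extension g x y) z =
      bilinear_extension g x (bilinear_extension g y z)"
    by (induction x rule: free_module_induct) (simp_all add: bilinear_extension_simps(1-4))
  show "bilinear_extension g (free_basis e) x = x"
    by (induction x rule: free_module_induct) (simp_all add: bilinear_extension_simps unit_left)
  show "bilinear_extension g x (free_basis e) = x"
    by (induction x rule: free_module_induct) (simp_all add: bilinear_extension_simps unit_right)
qed (simp_all add: bilinear_extension_simps free_scale_add_right free_scale_add_left
    free_scale_free_scale)

lemma linear_extension_bilinear_extension:
  assumes hom: "\<And>a b. \<phi> (g a b) = g' (\<phi> a) (\<phi> b)"
  shows "linear_extension \<phi> (bilinear_extension g x y) =
    bilinear_extension g' (linear_extension \<phi> x) (linear_extension \<phi> y)"
proof (induction x rule: free_module_induct)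
  case (basis a)
  show ?case
    by (induction y rule: free_module_induct)
      (simp_all add: bilinear_extension_simps linear_extension_simps hom)
qed (simp_all add: bilinear_extension_simps linear_extension_simps)

lemma linear_extension_left_inverse:
  assumes "\<And>a. \<psi> (\<phi> a) = a"
  shows "linear_extension \<psi> (linear_extension \<phi> x) = x"
  by (induction x rule: free_module_induct) (simp_all add: linear_extension_simps assms)

lemma bij_linear_extension:
  assumes "bij \<phi>"
  shows "bij (linear_extension \<phi>)"
proof (rule o_bij)
  show "linear_extension (inv \<phi>) \<circ> linear_extension \<phi> = id"
    using assms by (auto simp: linear_extension_left_inverse bij_is_inj)
  show "linear_extension \<phi> \<circ> linear_extension (inv \<phi>) = id"
    using assms by (auto simp: linear_extension_left_inverse bij_is_surj surj_f_inv_f)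
qed

lemma unital_algebra_iso_linear_extension:
  fixes \<phi> :: "'a \<Rightarrow> 'b"
  assumes "unital_assoc_algebra
      (free_scale :: 'k::{comm_ring, comm_monoid_mult} \<Rightarrow> ('a \<Rightarrow>\<^sub>0 'k) \<Rightarrow> ('a \<Rightarrow>\<^sub>0 'k))
      (bilinear_extension g) (free_basis e)"
    and "unital_assoc_algebra
      (free_scale :: 'k \<Rightarrow> ('b \<Rightarrow>\<^sub>0 'k) \<Rightarrow> ('b \<Rightarrow>\<^sub>0 'k))
      (bilinear_extension g') (free_basis e')"
    and "\<And>a b. \<phi> (g a b) = g' (\<phi> a) (\<phi> b)" and "\<phi> e = e'" and "bij \<phi>"
  shows "unital_algebra_iso
    (free_scale :: 'k \<Rightarrow> ('a \<Rightarrow>\<^sub>0 'k) \<Rightarrow> ('a \<Rightarrow>\<^sub>0 'k)) (bilinear_extension g) (free_basis e)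
    (free_scale :: 'k \<Rightarrow> ('b \<Rightarrow>\<^sub>0 'k) \<Rightarrow> ('b \<Rightarrow>\<^sub>0 'k)) (bilinear_extension g') (free_basis e')
    (linear_extension \<phi>)"
  using assms
  by (intro unital_algebra_iso.intro unital_algebra_iso_axioms.intro)
    (simp_all add: linear_extension_simps linear_extension_bilinear_extension[of \<phi> g g']
      bij_linear_extension)

lemma under_tree_assoc: "under_tree (under_tree R S) T = under_tree R (under_tree S T)"
  by (induction R) simp_all

lemma under_tree_Trivial_right: "under_tree S Trivial = S"
  by (induction S) simp_all

lemma unital_assoc_algebra_concat_product:
  "unital_assoc_algebra free_scale concat_product (free_basis [])"
  unfolding concat_product_def by (rule unital_assoc_algebra_bilinear_extension) simp_all

lemma unital_assoc_algebra_under_product: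
  "unital_assoc_algebra free_scale under_product (free_basis Trivial)"
  unfolding under_product_def
  by (rule unital_assoc_algebra_bilinear_extension)
    (simp_all add: under_tree_assoc under_tree_Trivial_right)

fun forest_to_tree :: "planar_forest \<Rightarrow> binary_tree" where
  "forest_to_tree [] = Trivial"
| "forest_to_tree (B_plus F # G) = Graft (forest_to_tree F) (forest_to_tree G)"

fun tree_to_forest :: "binary_tree \<Rightarrow> planar_forest" where
  "tree_to_forest Trivial = []"
| "tree_to_forest (Graft S T) = B_plus (tree_to_forest S) # tree_to_forest T"

lemma forest_to_tree_append:
  "forest_to_tree (F @ G) = under_tree (forest_to_tree F) (forest_to_tree G)"
  by (induction F rule: forest_to_tree.induct) simp_all

lemma bij_forest_to_tree: "bij forest_to_tree"
proof (rule o_bij)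
  show "tree_to_forest \<circ> forest_to_tree = id"
  proof
    fix F
    show "(tree_to_forest \<circ> forest_to_tree) F = id F"
      by (induction F rule: forest_to_tree.induct) simp_all
  qed
  show "forest_to_tree \<circ> tree_to_forest = id"
  proof
    fix T
    show "(forest_to_tree \<circ> tree_to_forest) T = id T"
      by (induction T) simp_all
  qed
qed

text \<open>
  Multiplicativity splits off the first tree of a forest, the condition on $B^+$ removes the root of
  that tree, and $(T \vee |) \backslash S = T \vee S$ reassembles the values. Hence the values on
  the basis are forced.
\<close>

lemma eq_forest_to_tree_on_basis:
  fixes \<Theta> :: "(planar_forest \<Rightarrow>\<^sub>0 'k::{comm_ring, comm_monoid_mult}) \<Rightarrow> (binary_tree \<Rightarrow>\<^sub>0 'k)"
  assumes unit: "\<Theta> (free_basis []) = free_basis Trivial"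
    and mult: "\<And>x y. \<Theta> (concat_product x y) = under_product (\<Theta> x) (\<Theta> y)"
    and B_plus: "\<And>F. \<Theta> (free_basis [B_plus F]) = B_right (\<Theta> (free_basis F))"
  shows "\<Theta> (free_basis F) = free_basis (forest_to_tree F)"
proof (induction F rule: forest_to_tree.induct)
  case 1
  show ?case
    by (simp add: unit)
next
  case (2 F G)
  have "free_basis (B_plus F # G) =
      (concat_product (free_basis [B_plus F]) (free_basis G) :: _ \<Rightarrow>\<^sub>0 'k)"
    by (simp add: concat_product_def bilinear_extension_simps)
  then have "\<Theta> (free_basis (B_plus F # G)) =
      under_product (B_right (\<Theta> (free_basis F))) (\<Theta> (free_basis G))"
    by (simp add: mult B_plus)
  then show ?case
    by (simp add: 2 B_right_def under_product_def linear_extension_simps bilinear_extension_simps)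
qed

theorem proposition4p3:
  "\<exists>!\<Theta> :: (planar_forest \<Rightarrow>\<^sub>0 'k::{comm_ring, comm_monoid_mult}) \<Rightarrow> (binary_tree \<Rightarrow>\<^sub>0 'k).
     unital_algebra_iso
       free_scale concat_product (free_basis [])
       free_scale under_product (free_basis Trivial) \<Theta> \<and>
     (\<forall>F :: planar_forest.
        \<Theta> (free_basis [B_plus F]) = B_right (\<Theta> (free_basis F)) \<and>
        B_right (\<Theta> (free_basis F)) = graft (\<Theta> (free_basis F)) (free_basis Trivial))"
proof (rule ex1I[where a = "linear_extension forest_to_tree"], intro conjI allI)
  show "unital_algebra_iso
       free_scale concat_product (free_basis [])
       free_scale under_product (free_basis Trivial)
       (linear_extension forest_to_tree ::
         (planar_forest \<Rightarrow>\<^sub>0 'k) \<Rightarrow> (binary_tree \<Rightarrow>\<^sub>0 'k))"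
    using unital_assoc_algebra_concat_product unital_assoc_algebra_under_product
    unfolding concat_product_def under_product_def
    by (rule unital_algebra_iso_linear_extension)
      (simp_all add: forest_to_tree_append bij_forest_to_tree)
next
  fix F :: planar_forest
  show "(linear_extension forest_to_tree (free_basis [B_plus F]) :: _ \<Rightarrow>\<^sub>0 'k) =
      B_right (linear_extension forest_to_tree (free_basis F))"
    by (simp add: B_right_def linear_extension_simps)
  show "(B_right (linear_extension forest_to_tree (free_basis F)) :: _ \<Rightarrow>\<^sub>0 'k) =
      graft (linear_extension forest_to_tree (free_basis F)) (free_basis Trivial)"
    by (simp add: B_right_def graft_def linear_extension_simps bilinear_extension_simps)
next
  fix \<Theta> :: "(planar_forest \<Rightarrow>\<^sub>0 'k) \<Rightarrow> (binary_tree \<Rightarrow>\<^sub>0 'k)"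
  assume \<Theta>: "unital_algebra_iso
       free_scale concat_product (free_basis [])
       free_scale under_product (free_basis Trivial) \<Theta> \<and>
     (\<forall>F :: planar_forest.
        \<Theta> (free_basis [B_plus F]) = B_right (\<Theta> (free_basis F)) \<and>
        B_right (\<Theta> (free_basis F)) = graft (\<Theta> (free_basis F)) (free_basis Trivial))"
  then interpret unital_algebra_iso
    free_scale concat_product "free_basis []" free_scale under_product "free_basis Trivial" \<Theta>
    by blast
  have basis: "\<Theta> (free_basis F) = free_basis (forest_to_tree F)" for F
    using \<Theta> by (intro eq_forest_to_tree_on_basis unit mult) blast
  show "\<Theta> = linear_extension forest_to_tree"
  proof
    fix x
    show "\<Theta> x = linear_extension forest_to_tree x"
      by (induction x rule: free_module_induct)
        (simp_all add: basis add scale linear_extension_simps)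
  qed
qed

end
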